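(* Let $K$ be the universal Knaster continuum and let $\mathrm{Homeo}^1(K)\le\mathrm{Homeo}(K)$ be the subgroup of homeomorphisms of degree $1$. Then the group $\mathrm{Homeo}(K)$ is not isomorphic to the direct product $\mathrm{Homeo}^1(K)\times\mathbb{Q}^\times$, where $\mathbb{Q}^\times$ is the multiplicative group of positive rational numbers.
   Context: Let $I=[0,1]$. A Knaster continuum is a space $\varprojlim(I,T_n^{n+1})$ with each $T_n^{n+1}:I\to I$ a continuous open surjection fixing $0$. The universal Knaster continuum $K$ is the (unique up to homeomorphism) Knaster continuum admitting continuous open surjections onto all Knaster continua. $\mathrm{Homeo}(K)$ is the group of homeomorphisms of $K$. Degree. For a continuous open $f:I\to I$ with $f(0)=0$ there are $0=x_0<\cdots<x_n=1$ such that $f$ maps each $[x_i,x_{i+1}]$ homeomorphically onto $[0,1]$; the number $n$ is $\deg(f)$. Write $K=\varprojlim(I_n,t_n^{n+1})_{n\ge1}$ with $I_n=I$ and each $t_n^{n+1}$ a standard tent map (the piecewise linear map of some degree $d$ with constant slope $\pm d$, fixing $0$), let $\pi_i^K$ be the coordinate projections and $t_1^i:I_i\to I_1$ the composite bonding map. For $f\in\mathrm{Homeo}(K)$ there are continuous open maps $f_i:I_i\to I$ fixing $0$ with $f_i\circ\pi_i^K\to\pi_1^K\circ f$ uniformly, and $\deg(f):=\lim_i \deg(f_i)/\deg(t_1^i)\in\mathbb{Q}^\times$; by results of Dębski the ratio is eventually constant, independent of the chosen $f_i$, and $\deg:\mathrm{Homeo}(K)\to\mathbb{Q}^\times$ is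 a group homomorphism. $\mathrm{Homeo}^1(K)$ is its kernel. *)

theory Defs
  imports "HOL-Analysis.Analysis" "HOL-Algebra.Coset" "HOL-Algebra.Bij"
begin

section \<open>Knaster continua\<close>

abbreviation I_top :: "real topology" where
  "I_top \<equiv> top_of_set {0..1}"

definition open_map_fix0 :: "(real \<Rightarrow> real) \<Rightarrow> bool" where
  "open_map_fix0 f \<longleftrightarrow> continuous_map I_top I_top f \<and> open_map I_top I_top f \<and> f 0 = 0"

definition knaster_bonding :: "(nat \<Rightarrow> real \<Rightarrow> real) \<Rightarrow> bool" where
  "knaster_bonding T \<longleftrightarrow> (\<forall>n. open_map_fix0 (T n) \<and> T n ` {0..1} = {0..1})"

text \<open>Inverse sequences are indexed from 0, so that \<open>T n\<close> maps the \<open>(n+1)\<close>-st factor to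
  the \<open>n\<close>-th one and the base factor is number 0.\<close>

definition inverse_limit :: "(nat \<Rightarrow> real \<Rightarrow> real) \<Rightarrow> (nat \<Rightarrow> real) topology" where
  "inverse_limit T =
     subtopology (product_topology (\<lambda>_. I_top) UNIV) {x. \<forall>n. T n (x (Suc n)) = x n}"

definition knaster_continuum :: "'a topology \<Rightarrow> bool" where
  "knaster_continuum K \<longleftrightarrow> (\<exists>T. knaster_bonding T \<and> K homeomorphic_space inverse_limit T)"

definition universal_knaster_continuum :: "'a topology \<Rightarrow> bool" where
  "universal_knaster_continuum K \<longleftrightarrow>
     knaster_continuum K \<and>
     (\<forall>T. knaster_bonding T \<longrightarrow>
        (\<exists>f. continuous_map K (inverse_limit T) f \<and> open_map K (inverse_limit T) f \<and>
             f ` topspace K = topspace (inverse_limit T)))"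

section \<open>Degree\<close>

definition has_map_degree :: "(real \<Rightarrow> real) \<Rightarrow> nat \<Rightarrow> bool" where
  "has_map_degree f n \<longleftrightarrow>
     (\<exists>x :: nat \<Rightarrow> real. x 0 = 0 \<and> x n = 1 \<and>
        (\<forall>i<n. x i < x (Suc i) \<and>
           homeomorphic_map (top_of_set {x i..x (Suc i)}) I_top f))"

definition map_degree :: "(real \<Rightarrow> real) \<Rightarrow> nat" where
  "map_degree f = (THE n. has_map_degree f n)"

text \<open>The piecewise linear map on the unit interval with slopes \<open>d, -d, d, \<dots>\<close> on the intervals
  \<open>[k/d, (k+1)/d]\<close>.\<close>

definition tent_map :: "nat \<Rightarrow> real \<Rightarrow> real" where
  "tent_map d x =
     (let k = \<lfloor>real d * x\<rfloor> in
      if even k then real d * x - of_int k else of_int k + 1 - real d * x)"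

text \<open>\<open>p n\<close> is the \<open>n\<close>-th coordinate projection in a presentation of \<open>K\<close> as the inverse limit
  of the standard tent maps of degrees \<open>d 0, d 1, \<dots>\<close>.\<close>

definition tent_presentation :: "'a topology \<Rightarrow> (nat \<Rightarrow> nat) \<Rightarrow> (nat \<Rightarrow> 'a \<Rightarrow> real) \<Rightarrow> bool" where
  "tent_presentation K d p \<longleftrightarrow>
     (\<forall>n. 1 \<le> d n) \<and>
     homeomorphic_map K (inverse_limit (\<lambda>n. tent_map (d n))) (\<lambda>x n. p n x)"

primrec bond :: "(nat \<Rightarrow> real \<Rightarrow> real) \<Rightarrow> nat \<Rightarrow> real \<Rightarrow> real" where
  "bond T 0 = id"
| "bond T (Suc i) = bond T i \<circ> T i"

definition homeo_degree ::
  "'a topology \<Rightarrow> (nat \<Rightarrow> nat) \<Rightarrow> (nat \<Rightarrow> 'a \<Rightarrow> real) \<Rightarrow> ('a \<Rightarrow> 'a) \<Rightarrow> rat" where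
  "homeo_degree K d p f =
     (THE q. \<exists>g. (\<forall>i. open_map_fix0 (g i)) \<and>
        uniform_limit (topspace K) (\<lambda>i x. g i (p i x)) (\<lambda>x. p 0 (f x)) sequentially \<and>
        (\<lambda>i. real (map_degree (g i)) / real (map_degree (bond (\<lambda>n. tent_map (d n)) i)))
          \<longlonglongrightarrow> of_rat q)"

section \<open>Groups\<close>

text \<open>As in \<^const>\<open>BijGroup\<close>, a homeomorphism is represented by the function that is
  \<^const>\<open>undefined\<close> outside the space.\<close>

definition Homeo :: "'a topology \<Rightarrow> ('a \<Rightarrow> 'a) monoid" where
  "Homeo K = (BijGroup (topspace K))
     \<lparr>carrier := {f \<in> Bij (topspace K). homeomorphic_map K K f}\<rparr>"

definition pos_rat_group :: "rat monoid" where
  "pos_rat_group = \<lparr>carrier = {q. 0 < q}, mult = (*), one = 1\<rparr>"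

definition Homeo1 ::
  "'a topology \<Rightarrow> (nat \<Rightarrow> nat) \<Rightarrow> (nat \<Rightarrow> 'a \<Rightarrow> real) \<Rightarrow> ('a \<Rightarrow> 'a) monoid" where
  "Homeo1 K d p = (Homeo K)
     \<lparr>carrier := kernel (Homeo K) pos_rat_group (homeo_degree K d p)\<rparr>"

end

theory Submission
  imports Defs
begin

text \<open>The two groups are told apart by their centres. In a product \<open>N \<times> \<rat>\<^sup>\<times>\<close> all pairs
  \<open>(1, q)\<close> are central, whereas the centre of \<open>Homeo(K)\<close> is trivial.

  For the triviality of the centre, write \<open>K\<close> as an inverse limit of tent maps. The tent map of
  degree \<open>d\<close> is \<open>x \<mapsto> \<phi>(d x)\<close>, where \<open>\<phi>\<close> folds the real line onto the unit interval, that is,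
  \<open>\<phi>\<close> is the quotient map for the infinite dihedral group generated by \<open>t \<mapsto> -t\<close> and
  \<open>t \<mapsto> t + 2\<close>. An increasing homeomorphism \<open>G\<close> of the line that commutes with this group
  commutes with \<open>\<phi>\<close>, and so do its rescalings \<open>t \<mapsto> G(k t) / k\<close> for positive integers \<open>k\<close>.
  Hence \<open>G\<close> lifts to a homeomorphism of \<open>K\<close>: it acts on the \<open>n\<close>-th coordinate as
  \<open>t \<mapsto> G(D t) / D\<close>, where \<open>D\<close> is the degree of the bonding map from level \<open>n\<close> to level 0
  (\<open>exists_homeo_lifting\<close>).

  Let \<open>c\<close> be central and suppose that \<open>c(x)\<close> has its base coordinate \<open>b\<close> inside the open
  interval, different from the base coordinate \<open>a\<close> of \<open>x\<close>. Some \<open>G\<close> as above fixes \<open>a\<close> and moves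
  \<open>b\<close>. Its lift fixes every point over \<open>a\<close>, in particular \<open>x\<close>, hence it fixes \<open>c(x)\<close>, which
  is absurd. Dropping initial coordinates turns any level into the base level, so the same
  holds for all coordinates. Therefore a point that \<open>c\<close> moves is sent to a point all of
  whose coordinates are 0 or 1. There are at most two of these: the zero point, and one whose
  coordinates are eventually 1. The zero point is the end of a ray of fixed points, so \<open>c\<close> fixes
  it by continuity; and if \<open>c\<close> moved \<open>x\<close>, it would also move \<open>c(x)\<close>, so \<open>c(x)\<close> and
  \<open>c(c(x))\<close> would be two distinct nonzero points of this kind (\<open>homeo_commuting_imp_id\<close>).\<close>

section \<open>Folding the line onto the interval\<close>

text \<open>The distance to the nearest even integer, in a closed form from which continuity and the
  invariance under \<open>t \<mapsto> -t\<close> and \<open>t \<mapsto> t + 2\<close> can be read off.\<close>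

definition fold_line :: "real \<Rightarrow> real" where
  "fold_line t = arccos (cos (pi * t)) / pi"

text \<open>The unit interval is a fundamental domain of the dihedral group: a point of the orbit of \<open>t\<close>
  that lies in it must be the folded point. All later computations with folding go through this
  characterisation.\<close>

lemma fold_line_eqI:
  assumes "0 \<le> s" "s \<le> 1" "s = t + 2 * of_int m \<or> s = 2 * of_int m - t"
  shows "fold_line t = s"
proof -
  have per: "cos (u + of_int m * (2 * pi)) = cos u" for u
    by (simp add: cos_add mult.commute[of "of_int m"])
  have "cos (pi * s) = cos (pi * t)"
    using assms(3)
  proof
    assume "s = t + 2 * of_int m"
    then show ?thesis using per[of "pi * t"] by (simp add: algebra_simps)
  next
    assume "s = 2 * of_int m - t"
    then have "pi * s = - (pi * t) + of_int m * (2 * pi)" by (simp add: right_diff_distrib)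
    then show ?thesis using per[of "- (pi * t)"] by simp
  qed
  moreover have "arccos (cos (pi * s)) = pi * s"
    by (rule arccos_cos) (use assms in auto)
  ultimately show ?thesis by (simp add: fold_line_def)
qed

lemma tent_map_orbit:
  "0 \<le> tent_map d x \<and> tent_map d x \<le> 1 \<and>
   (\<exists>m. tent_map d x = real d * x + 2 * of_int m \<or> tent_map d x = 2 * of_int m - real d * x)"
proof -
  define k where "k = \<lfloor>real d * x\<rfloor>"
  have k: "of_int k \<le> real d * x" "real d * x < of_int k + 1"
    unfolding k_def by linarith+
  show ?thesis
  proof (cases "even k")
    case True
    then obtain m where m: "k = 2 * m" by blast
    have "tent_map d x = real d * x - of_int k"
      using True by (simp add: tent_map_def k_def Let_def)
    moreover have "real d * x - of_int k = real d * x + 2 * of_int (- m)" using m by simp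
    ultimately show ?thesis using k by (smt (verit))
  next
    case False
    then obtain m where m: "k = 2 * m + 1" by (meson oddE)
    have "tent_map d x = of_int k + 1 - real d * x"
      using False by (simp add: tent_map_def k_def Let_def)
    moreover have "of_int k + 1 - real d * x = 2 * of_int (m + 1) - real d * x" using m by simp
    ultimately show ?thesis using k by (smt (verit))
  qed
qed

lemma tent_map_eq_fold_line: "tent_map d x = fold_line (real d * x)"
  using tent_map_orbit[of d x] fold_line_eqI by metis

lemma fold_line_orbit:
  obtains m where "fold_line t = t + 2 * of_int m" | m where "fold_line t = 2 * of_int m - t"
  using tent_map_orbit[of 1 t] tent_map_eq_fold_line[of 1 t] by auto

lemma fold_line_in_unit: "0 \<le> fold_line t" "fold_line t \<le> 1"
  using tent_map_orbit[of 1 t] tent_map_eq_fold_line[of 1 t] by auto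

lemma fold_line_id: "0 \<le> t \<Longrightarrow> t \<le> 1 \<Longrightarrow> fold_line t = t"
  by (rule fold_line_eqI[of _ _ 0]) auto

lemma fold_line_of_nat: "fold_line (real k) \<in> {0, 1}"
proof (cases "even k")
  case True
  then obtain m where "k = 2 * m" by blast
  then have "fold_line (real k) = 0"
    by (intro fold_line_eqI[of _ _ "- int m"]) auto
  then show ?thesis by simp
next
  case False
  then obtain m where "k = 2 * m + 1" by (meson oddE)
  then have "fold_line (real k) = 1"
    by (intro fold_line_eqI[of _ _ "- int m"]) auto
  then show ?thesis by simp
qed

text \<open>Multiplication by an integer maps dihedral orbits into dihedral orbits. This is why composites
  of tent maps are again tent maps.\<close>

lemma fold_line_mult_fold_line: "fold_line (real k * fold_line t) = fold_line (real k * t)"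
proof -
  obtain m where m: "fold_line (real k * t) = real k * t + 2 * of_int m \<or>
      fold_line (real k * t) = 2 * of_int m - real k * t"
    using fold_line_orbit[of "real k * t"] by metis
  show ?thesis
  proof (cases t rule: fold_line_orbit)
    case (1 j)
    have t: "t = fold_line t - 2 * of_int j" using 1 by simp
    have "fold_line (real k * t) = real k * fold_line t + 2 * of_int (m - int k * j) \<or>
        fold_line (real k * t) = 2 * of_int (m + int k * j) - real k * fold_line t"
      using m unfolding 1 by (auto simp: algebra_simps)
    then show ?thesis using fold_line_in_unit fold_line_eqI by metis
  next
    case (2 j)
    have "fold_line (real k * t) = 2 * of_int (m + int k * j) - real k * fold_line t \<or>
        fold_line (real k * t) = real k * fold_line t + 2 * of_int (m - int k * j)"
      using m unfolding 2 by (auto simp: algebra_simps)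
    then show ?thesis using fold_line_in_unit fold_line_eqI by metis
  qed
qed

lemma continuous_map_tent_map: "continuous_map I_top I_top (tent_map k)"
  unfolding tent_map_eq_fold_line fold_line_def
  using fold_line_in_unit
  by (auto simp: fold_line_def intro!: continuous_intros)

section \<open>Homeomorphisms of the line that commute with the folding\<close>

text \<open>Continuity and the continuity of the inverse follow from monotonicity and bijectivity, so
  that the definition passes to inverses without topology.\<close>

definition dihedral_homeo :: "(real \<Rightarrow> real) \<Rightarrow> bool" where
  "dihedral_homeo G \<longleftrightarrow> bij G \<and> mono G \<and> (\<forall>t. G (- t) = - G t) \<and> (\<forall>t. G (t + 2) = G t + 2)"

lemma dihedral_homeo_continuous:
  assumes "dihedral_homeo G"
  shows "continuous_on A G"
proof -
  have "range G = UNIV" "mono G"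
    using assms by (auto simp: dihedral_homeo_def bij_def)
  then have "continuous_on UNIV G"
    by (intro continuous_onI_mono) (auto simp: mono_def)
  then show ?thesis by (rule continuous_on_subset) simp
qed

lemma dihedral_homeo_inv:
  assumes "dihedral_homeo G"
  shows "dihedral_homeo (inv_into UNIV G)"
proof -
  have G: "bij G" "mono G" "\<And>t. G (- t) = - G t" "\<And>t. G (t + 2) = G t + 2"
    using assms by (auto simp: dihedral_homeo_def)
  have GH: "G (inv_into UNIV G t) = t" for t using G(1) by (meson bij_inv_eq_iff)
  have HI: "inv_into UNIV G t = s" if "G s = t" for s t using that bij_is_inj[OF G(1)] by auto
  have "mono (inv_into UNIV G)"
  proof (rule monoI, rule ccontr)
    fix x y :: real
    assume "x \<le> y" and n: "\<not> inv_into UNIV G x \<le> inv_into UNIV G y"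
    then have "G (inv_into UNIV G y) \<le> G (inv_into UNIV G x)" using G(2) by (simp add: monoD)
    with \<open>x \<le> y\<close> have "x = y" by (simp add: GH)
    with n show False by simp
  qed
  then show ?thesis
    unfolding dihedral_homeo_def using G GH by (auto intro!: HI bij_imp_bij_inv)
qed

lemma dihedral_homeo_add_even:
  assumes "dihedral_homeo G"
  shows "G (t + 2 * of_int m) = G t + 2 * of_int m"
proof -
  have step: "G (t + 2) = G t + 2" for t using assms by (simp add: dihedral_homeo_def)
  have nat: "G (t + 2 * real n) = G t + 2 * real n" for t n
  proof (induction n)
    case (Suc n)
    have "G (t + 2 * real (Suc n)) = G ((t + 2 * real n) + 2)" by (simp add: algebra_simps)
    then show ?case using Suc step by simp
  qed simp
  show ?thesis
  proof (cases m)
    case (nonneg n)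
    then show ?thesis using nat[of t n] by simp
  next
    case (neg n)
    then have "t + 2 * of_int m = t - 2 * real (Suc n)" by simp
    then show ?thesis using nat[of "t + 2 * of_int m" "Suc n"] neg by simp
  qed
qed

lemma dihedral_homeo_sub_even:
  assumes "dihedral_homeo G"
  shows "G (2 * of_int m - t) = 2 * of_int m - G t"
  using dihedral_homeo_add_even[OF assms, of "- t" m] assms
  by (simp add: dihedral_homeo_def)

lemma dihedral_homeo_in_unit:
  assumes "dihedral_homeo G" "0 \<le> t" "t \<le> 1"
  shows "0 \<le> G t" "G t \<le> 1"
proof -
  have "G 0 = 0" using dihedral_homeo_sub_even[OF assms(1), of 0 0] by simp
  moreover have "G 1 = 1" using dihedral_homeo_sub_even[OF assms(1), of 1 1] by simp
  ultimately show "0 \<le> G t" "G t \<le> 1"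
    using assms monoD[of G 0 t] monoD[of G t 1] by (auto simp: dihedral_homeo_def)
qed

lemma fold_line_dihedral_homeo:
  assumes "dihedral_homeo G"
  shows "fold_line (G t) = G (fold_line t)"
proof -
  have "0 \<le> G (fold_line t)" "G (fold_line t) \<le> 1"
    using dihedral_homeo_in_unit[OF assms fold_line_in_unit] by auto
  then show ?thesis
    using dihedral_homeo_add_even[OF assms] dihedral_homeo_sub_even[OF assms]
    by (cases t rule: fold_line_orbit) (metis fold_line_eqI)+
qed

text \<open>A homeomorphism that commutes with the dihedral group and fixes one point fixes its
  whole orbit.\<close>

lemma dihedral_homeo_fixed:
  assumes "dihedral_homeo G" "G (fold_line t) = fold_line t"
  shows "G t = t"
  using assms(2) dihedral_homeo_add_even[OF assms(1)] dihedral_homeo_sub_even[OF assms(1)]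
  by (cases t rule: fold_line_orbit) force+

lemma dihedral_homeo_rescale:
  assumes G: "dihedral_homeo G" and k: "0 < k"
  shows "dihedral_homeo (\<lambda>t. G (real k * t) / real k)"
proof -
  have "bij G" "mono G" "\<And>t. G (- t) = - G t" using G by (auto simp: dihedral_homeo_def)
  then have "mono (\<lambda>t. G (real k * t) / real k)"
    "\<And>t. G (real k * - t) / real k = - (G (real k * t) / real k)"
    using k by (simp_all add: mono_def divide_right_mono)
  moreover have "G (real k * (t + 2)) / real k = G (real k * t) / real k + 2" for t
  proof -
    have "real k * (t + 2) = real k * t + 2 * of_int (int k)" by (simp add: algebra_simps)
    then have "G (real k * (t + 2)) = G (real k * t) + 2 * of_int (int k)"
      by (simp only: dihedral_homeo_add_even[OF G])
    then show ?thesis using k by (simp add: add_divide_distrib)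
  qed
  moreover have "bij (\<lambda>t. G (real k * t) / real k)"
  proof (rule bij_betw_byWitness[where f' = "\<lambda>t. inv_into UNIV G (real k * t) / real k"])
  qed (use k \<open>bij G\<close> in \<open>auto simp: bij_def surj_f_inv_f\<close>)
  ultimately show ?thesis by (simp add: dihedral_homeo_def)
qed

text \<open>A perturbation of the identity inside the dihedral symmetry whose fixed points are the integers
  and the orbit of \<open>a\<close>. The factor \<open>1/(4\<pi>)\<close> keeps the derivative at least \<open>1/2\<close>.\<close>

definition bump :: "real \<Rightarrow> real \<Rightarrow> real" where
  "bump a t = t + sin (pi * t) * (cos (pi * t) - cos (pi * a)) / (4 * pi)"

lemma bump_strict_mono: "strict_mono (bump a)"
proof (rule strict_monoI)
  fix x y :: real
  assume "x < y"
  show "bump a x < bump a y"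
  proof (rule DERIV_pos_imp_increasing[OF \<open>x < y\<close>])
    fix t
    let ?c = "cos (pi * t)" and ?s = "sin (pi * t)"
    let ?D = "1 + (?c * (?c - cos (pi * a)) - ?s * ?s) / 4"
    have "(bump a has_real_derivative ?D) (at t)"
      unfolding bump_def by (auto intro!: derivative_eq_intros simp: field_simps)
    moreover have "0 < ?D"
    proof -
      have "?s * ?s = 1 - ?c * ?c"
        using sin_cos_squared_add[of "pi * t"] by (simp add: power2_eq_square)
      moreover have "\<bar>?c * cos (pi * a)\<bar> \<le> 1"
        by (metis abs_cos_le_one abs_ge_zero abs_mult mult_le_one)
      moreover have "?c * (?c - cos (pi * a)) = ?c * ?c - ?c * cos (pi * a)"
        by (rule right_diff_distrib)
      moreover have "0 \<le> ?c * ?c" by simp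
      moreover have "0 < 1 + (X - S) / 4"
        if "S = 1 - C" "\<bar>P\<bar> \<le> 1" "X = C - P" "0 \<le> C" for X S C P :: real
        using that by (simp add: field_simps)
      ultimately show ?thesis by blast
    qed
    ultimately show "\<exists>D. (bump a has_real_derivative D) (at t) \<and> 0 < D" by blast
  qed
qed

lemma dihedral_homeo_bump: "dihedral_homeo (bump a)"
proof -
  have near: "\<bar>bump a t - t\<bar> \<le> 1" for t
  proof -
    have "\<bar>sin (pi * t) * (cos (pi * t) - cos (pi * a))\<bar> \<le> 1 * 2"
      unfolding abs_mult
      by (rule mult_mono)
        (use abs_cos_le_one[of "pi * t"] abs_cos_le_one[of "pi * a"] in \<open>linarith | simp\<close>)+
    also have "\<dots> \<le> 4 * pi" using pi_ge_two by simp
    finally show ?thesis by (simp add: bump_def)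
  qed
  have "\<exists>t. bump a t = y" for y
  proof -
    have "continuous_on {y - 1..y + 1} (bump a)"
      unfolding bump_def by (intro continuous_intros) auto
    moreover have "bump a (y - 1) \<le> y" "y \<le> bump a (y + 1)"
      using near[of "y - 1"] near[of "y + 1"] by auto
    ultimately show ?thesis using IVT'[of "bump a" "y - 1" y "y + 1"] by auto
  qed
  then have "surj (bump a)" by (metis surjI)
  moreover have "bump a (t + 2) = bump a t + 2" for t
  proof -
    have "pi * (t + 2) = pi * t + 2 * pi" by (simp add: algebra_simps)
    then show ?thesis by (simp add: bump_def)
  qed
  ultimately show ?thesis
    using bump_strict_mono[of a]
    by (auto simp: dihedral_homeo_def bij_def strict_mono_mono strict_mono_imp_inj_on)
       (simp add: bump_def)
qed

lemma bump_fixed_point_iff: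
  assumes "0 \<le> a" "a \<le> 1" "0 < b" "b < 1"
  shows "bump a b = b \<longleftrightarrow> b = a"
proof -
  have "sin (pi * b) \<noteq> 0"
    using sin_gt_zero[of "pi * b"] assms by simp
  moreover have "cos (pi * b) = cos (pi * a) \<longleftrightarrow> b = a"
    using cos_inj_pi[of "pi * b" "pi * a"] assms by auto
  ultimately show ?thesis by (auto simp: bump_def)
qed

section \<open>Lifting to the inverse limit\<close>

lemma topspace_inverse_limit:
  "topspace (inverse_limit T) = {x. (\<forall>n. x n \<in> {0..1}) \<and> (\<forall>n. T n (x (Suc n)) = x n)}"
  by (auto simp: inverse_limit_def PiE_def)

lemma continuous_map_inverse_limit_iff:
  "continuous_map X (inverse_limit T) h \<longleftrightarrow>
     (\<forall>n. continuous_map X I_top (\<lambda>x. h x n)) \<and> (\<forall>x \<in> topspace X. \<forall>n. T n (h x (Suc n)) = h x n)"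
  unfolding inverse_limit_def
  by (auto simp: continuous_map_in_subtopology continuous_map_componentwise_UNIV)

lemma continuous_map_inverse_limit_coordinate:
  "continuous_map (inverse_limit T) I_top (\<lambda>x. x n)"
  unfolding inverse_limit_def
  by (intro continuous_map_from_subtopology continuous_map_product_projection) simp

text \<open>On level \<open>n\<close> the folding onto the base level is \<open>t \<mapsto> \<phi>(D t)\<close> with \<open>D\<close> the product of the
  first \<open>n\<close> degrees, so \<open>G\<close> has to be conjugated by multiplication with \<open>D\<close>.\<close>

definition level_map :: "(nat \<Rightarrow> nat) \<Rightarrow> (real \<Rightarrow> real) \<Rightarrow> (nat \<Rightarrow> real) \<Rightarrow> nat \<Rightarrow> real" where
  "level_map d G x n = G (real (\<Prod>i<n. d i) * x n) / real (\<Prod>i<n. d i)"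

text \<open>The bonding map at \<open>n\<close> intertwines the actions on levels \<open>n + 1\<close> and \<open>n\<close>: with \<open>F\<close> the
  action on level \<open>n\<close>, multiplication by \<open>d n\<close> conjugates the action on level \<open>n + 1\<close> to \<open>F\<close>,
  and folding commutes with \<open>F\<close>.\<close>

lemma continuous_map_level_map:
  assumes d: "\<And>n. 1 \<le> d n" and G: "dihedral_homeo G"
  shows "continuous_map (inverse_limit (\<lambda>n. tent_map (d n))) (inverse_limit (\<lambda>n. tent_map (d n)))
    (level_map d G)"
  unfolding continuous_map_inverse_limit_iff
proof (intro conjI allI ballI)
  let ?L = "inverse_limit (\<lambda>n. tent_map (d n))"
  fix n
  define D where "D = (\<Prod>i<n. d i)"
  define F where "F t = G (real D * t) / real D" for t
  have "0 < D" unfolding D_def using d by (intro prod_pos) (simp add: Suc_le_eq)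
  then have F: "dihedral_homeo F" unfolding F_def by (rule dihedral_homeo_rescale[OF G])
  have "continuous_map I_top I_top F"
    using dihedral_homeo_continuous[OF F] dihedral_homeo_in_unit[OF F] by auto
  from continuous_map_compose[OF continuous_map_inverse_limit_coordinate this]
  show "continuous_map ?L I_top (\<lambda>x. level_map d G x n)"
    by (simp add: level_map_def F_def D_def o_def)
  fix x
  assume "x \<in> topspace ?L"
  then have x: "x n = fold_line (real (d n) * x (Suc n))"
    by (metis (mono_tags, lifting) mem_Collect_eq tent_map_eq_fold_line topspace_inverse_limit)
  have "real (d n) * level_map d G x (Suc n) = F (real (d n) * x (Suc n))"
    using d[of n] by (simp add: level_map_def F_def D_def algebra_simps)
  then show "tent_map (d n) (level_map d G x (Suc n)) = level_map d G x n"
    using fold_line_dihedral_homeo[OF F] x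
    by (simp add: tent_map_eq_fold_line level_map_def F_def D_def)
qed

lemma homeomorphic_map_level_map:
  assumes d: "\<And>n. 1 \<le> d n" and G: "dihedral_homeo G"
  shows "homeomorphic_map (inverse_limit (\<lambda>n. tent_map (d n)))
    (inverse_limit (\<lambda>n. tent_map (d n))) (level_map d G)"
proof -
  have "d n \<noteq> 0" for n using d[of n] by simp
  then have "real (\<Prod>i<n. d i) \<noteq> 0" for n by simp
  moreover have "bij G" using G by (simp add: dihedral_homeo_def)
  ultimately have "level_map d (inv_into UNIV G) (level_map d G x) = x"
      "level_map d G (level_map d (inv_into UNIV G) x) = x" for x
    by (auto simp: level_map_def fun_eq_iff bij_def surj_f_inv_f simp del: of_nat_prod)
  then show ?thesis
    using continuous_map_level_map[OF d G] continuous_map_level_map[OF d dihedral_homeo_inv[OF G]]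
    by (intro homeomorphic_maps_imp_map[where g = "level_map d (inv_into UNIV G)"])
       (auto simp: homeomorphic_maps_def)
qed

section \<open>Tent presentations\<close>

text \<open>Forgetting the base level loses nothing, since its coordinate is determined by the next one.
  Facts about the base level thereby transfer to every level.\<close>

lemma tent_presentation_Suc:
  assumes "tent_presentation K d p"
  shows "tent_presentation K (\<lambda>n. d (Suc n)) (\<lambda>n. p (Suc n))"
proof -
  let ?L = "inverse_limit (\<lambda>n. tent_map (d n))" and ?M = "inverse_limit (\<lambda>n. tent_map (d (Suc n)))"
  let ?s = "\<lambda>(x :: nat \<Rightarrow> real) n. x (Suc n)"
  let ?t = "\<lambda>(y :: nat \<Rightarrow> real) n. case n of 0 \<Rightarrow> tent_map (d 0) (y 0) | Suc m \<Rightarrow> y m"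
  have "continuous_map ?L ?M ?s"
    unfolding continuous_map_inverse_limit_iff
  proof (intro conjI allI ballI)
    fix n
    show "continuous_map ?L I_top (\<lambda>x. x (Suc n))"
      by (rule continuous_map_inverse_limit_coordinate)
    show "tent_map (d (Suc n)) (x (Suc (Suc n))) = x (Suc n)" if "x \<in> topspace ?L" for x
      using that unfolding topspace_inverse_limit by blast
  qed
  moreover have "continuous_map ?M ?L ?t"
    unfolding continuous_map_inverse_limit_iff
  proof (intro conjI allI ballI)
    fix n
    show "continuous_map ?M I_top (\<lambda>y. ?t y n)"
    proof (cases n)
      case 0
      have "continuous_map ?M I_top (tent_map (d 0) \<circ> (\<lambda>y. y 0))"
        by (rule continuous_map_compose[OF continuous_map_inverse_limit_coordinate
              continuous_map_tent_map])
      then show ?thesis unfolding 0 by (simp only: o_def nat.case)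
    next
      case (Suc m)
      show ?thesis
        unfolding Suc nat.case by (rule continuous_map_inverse_limit_coordinate)
    qed
    show "tent_map (d n) (?t y (Suc n)) = ?t y n" if "y \<in> topspace ?M" for y
      using that unfolding topspace_inverse_limit by (cases n) simp_all
  qed
  moreover have "?t (?s x) = x" if "x \<in> topspace ?L" for x
    using that by (auto simp: topspace_inverse_limit fun_eq_iff split: nat.split)
  ultimately have "homeomorphic_map ?L ?M ?s"
    by (intro homeomorphic_maps_imp_map[where g = ?t]) (auto simp: homeomorphic_maps_def)
  then show ?thesis
    using assms homeomorphic_map_compose by (fastforce simp: tent_presentation_def o_def)
qed

lemma tent_presentation_shift:
  "tent_presentation K d p \<Longrightarrow> tent_presentation K (\<lambda>n. d (n + N)) (\<lambda>n. p (n + N))"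
proof (induction N)
  case (Suc N)
  then show ?case using tent_presentation_Suc[of K "\<lambda>n. d (n + N)" "\<lambda>n. p (n + N)"] by simp
qed simp

lemma tent_presentation_coordinate:
  assumes "tent_presentation K d p" "x \<in> topspace K"
  shows "0 \<le> p n x" "p n x \<le> 1" "p n x = fold_line (real (d n) * p (Suc n) x)"
proof -
  have "(\<lambda>n. p n x) \<in> topspace (inverse_limit (\<lambda>n. tent_map (d n)))"
    using assms homeomorphic_imp_surjective_map unfolding tent_presentation_def by fastforce
  then show "0 \<le> p n x" "p n x \<le> 1" "p n x = fold_line (real (d n) * p (Suc n) x)"
    by (auto simp: topspace_inverse_limit tent_map_eq_fold_line)
qed

lemma tent_presentation_eqI:
  assumes tp: "tent_presentation K d p" and xy: "x \<in> topspace K" "y \<in> topspace K"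
    and eq: "\<And>n. N \<le> n \<Longrightarrow> p n x = p n y"
  shows "x = y"
proof -
  have "p n x = p n y" for n
  proof (induction "N - n" arbitrary: n)
    case 0
    then show ?case using eq by simp
  next
    case (Suc k)
    then have "p (Suc n) x = p (Suc n) y" by simp
    then show ?case
      using tent_presentation_coordinate(3)[OF tp] xy by metis
  qed
  moreover have "inj_on (\<lambda>x n. p n x) (topspace K)"
    using tp homeomorphic_imp_injective_map by (auto simp: tent_presentation_def)
  ultimately show ?thesis using xy by (auto dest: inj_onD)
qed

lemma fold_line_composite_bonding:
  assumes "tent_presentation K d p" "x \<in> topspace K"
  shows "fold_line (real (\<Prod>i<n. d i) * p n x) = p 0 x"
proof (induction n)
  case 0
  then show ?case
    using tent_presentation_coordinate(1,2)[OF assms, of 0] by (simp add: fold_line_id)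
next
  case (Suc n)
  have "real (\<Prod>i<Suc n. d i) * p (Suc n) x = real (\<Prod>i<n. d i) * (real (d n) * p (Suc n) x)"
    by simp
  then have "fold_line (real (\<Prod>i<Suc n. d i) * p (Suc n) x) = fold_line (real (\<Prod>i<n. d i) * p n x)"
    by (metis fold_line_mult_fold_line tent_presentation_coordinate(3)[OF assms])
  then show ?case using Suc by simp
qed

text \<open>The source of homeomorphisms against which a central element is tested.\<close>

lemma exists_homeo_lifting:
  assumes tp: "tent_presentation K d p" and G: "dihedral_homeo G"
  obtains h where "homeomorphic_map K K h"
    "\<And>x n. x \<in> topspace K \<Longrightarrow> p n (h x) = G (real (\<Prod>i<n. d i) * p n x) / real (\<Prod>i<n. d i)"
proof -
  let ?L = "inverse_limit (\<lambda>n. tent_map (d n))" and ?P = "\<lambda>x n. p n x"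
  have d: "1 \<le> d n" for n using tp by (simp add: tent_presentation_def)
  have P: "homeomorphic_map K ?L ?P" using tp by (simp add: tent_presentation_def)
  then obtain Q where Q: "homeomorphic_maps K ?L ?P Q" using homeomorphic_map_maps by blast
  have L: "homeomorphic_map ?L ?L (level_map d G)" by (rule homeomorphic_map_level_map[OF d G])
  have Q': "homeomorphic_map ?L K Q" using Q homeomorphic_maps_map by blast
  have "homeomorphic_map K K (Q \<circ> (level_map d G \<circ> ?P))"
    using homeomorphic_map_compose[OF homeomorphic_map_compose[OF P L] Q'] .
  moreover have "p n ((Q \<circ> (level_map d G \<circ> ?P)) x) =
      G (real (\<Prod>i<n. d i) * p n x) / real (\<Prod>i<n. d i)" if "x \<in> topspace K" for x n
  proof -
    have "level_map d G (?P x) \<in> topspace ?L"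
      using that homeomorphic_imp_surjective_map[OF P] homeomorphic_imp_surjective_map[OF L]
      by blast
    then have "?P (Q (level_map d G (?P x))) = level_map d G (?P x)"
      using Q by (auto simp: homeomorphic_maps_def)
    then show ?thesis by (simp add: level_map_def fun_eq_iff)
  qed
  ultimately show ?thesis using that by blast
qed

section \<open>Homeomorphisms that commute with all others\<close>

text \<open>Whenever a homeomorphism \<open>h\<close> fixes \<open>x\<close>, it also fixes \<open>c x\<close>. The lift of a bump with
  parameter \<open>p 0 x\<close> fixes \<open>x\<close>, because each coordinate of \<open>x\<close>, rescaled by the degree, lies in
  the orbit of \<open>p 0 x\<close>; but the bump moves all points of the open interval other than \<open>p 0 x\<close>.\<close>

lemma homeo_commuting_coordinate_0:
  assumes tp: "tent_presentation K d p" and c: "homeomorphic_map K K c"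
    and comm: "\<And>h x. homeomorphic_map K K h \<Longrightarrow> x \<in> topspace K \<Longrightarrow> c (h x) = h (c x)"
    and x: "x \<in> topspace K" and nz: "p 0 (c x) \<notin> {0, 1}"
  shows "p 0 (c x) = p 0 x"
proof -
  let ?G = "bump (p 0 x)"
  obtain h where h: "homeomorphic_map K K h"
    and ph: "\<And>x n. x \<in> topspace K \<Longrightarrow>
      p n (h x) = ?G (real (\<Prod>i<n. d i) * p n x) / real (\<Prod>i<n. d i)"
    using exists_homeo_lifting[OF tp dihedral_homeo_bump] by blast
  have d: "d n \<noteq> 0" for n using tp by (metis not_one_le_zero tent_presentation_def)
  have inK: "h x \<in> topspace K" "c x \<in> topspace K"
    using h c x homeomorphic_imp_surjective_map by blast+
  have "p n (h x) = p n x" for n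
  proof -
    let ?t = "real (\<Prod>i<n. d i) * p n x"
    have "?G (fold_line ?t) = fold_line ?t"
      by (simp add: fold_line_composite_bonding[OF tp x] bump_def del: of_nat_prod)
    then have "?G ?t = ?t" by (rule dihedral_homeo_fixed[OF dihedral_homeo_bump])
    then show ?thesis using ph[OF x, of n] d by simp
  qed
  then have "h x = x" using tent_presentation_eqI[OF tp inK(1) x] by blast
  then have "h (c x) = c x" using comm[OF h x] by simp
  then have "?G (p 0 (c x)) = p 0 (c x)" using ph[OF inK(2), of 0] by simp
  moreover have "0 < p 0 (c x)" "p 0 (c x) < 1"
    using nz tent_presentation_coordinate[OF tp inK(2), of 0] by auto
  ultimately show ?thesis
    using bump_fixed_point_iff tent_presentation_coordinate[OF tp x, of 0] by blast
qed

lemma homeo_commuting_imp_id: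
  assumes tp: "tent_presentation K d p" and c: "homeomorphic_map K K c"
    and comm: "\<And>h x. homeomorphic_map K K h \<Longrightarrow> x \<in> topspace K \<Longrightarrow> c (h x) = h (c x)"
    and x: "x \<in> topspace K"
  shows "c x = x"
proof -
  let ?L = "inverse_limit (\<lambda>n. tent_map (d n))" and ?P = "\<lambda>x n. p n x"
  let ?D = "\<lambda>n. real (\<Prod>i<n. d i)"
  note coord = tent_presentation_coordinate[OF tp]
  define E where "E = {y \<in> topspace K. \<forall>n. p n y \<in> {0, 1}}"
  have d: "1 \<le> d n" for n using tp by (simp add: tent_presentation_def)
  then have d0: "d n \<noteq> 0" for n by (metis not_one_le_zero)
  have D: "1 \<le> ?D n" for n
    using d by (metis (no_types, lifting) of_nat_1 of_nat_le_iff prod_ge_1)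
  have cK: "c y \<in> topspace K" if "y \<in> topspace K" for y
    using that c homeomorphic_imp_surjective_map by blast
  have c_inj: "inj_on c (topspace K)" using c homeomorphic_imp_injective_map by blast
  \<comment> \<open>0 and 1 are mapped to 0 or 1 by each tent map; so once a coordinate of \<open>c y\<close> is interior, all
    later ones are, and they agree with those of \<open>y\<close>.\<close>
  have moved: "c y \<in> E" if y: "y \<in> topspace K" and ne: "c y \<noteq> y" for y
  proof (rule ccontr)
    assume "c y \<notin> E"
    then obtain N where N: "p N (c y) \<notin> {0, 1}" using cK[OF y] by (auto simp: E_def)
    have "p n (c y) = p n y" if "N \<le> n" for n
    proof -
      have "p n (c y) \<notin> {0, 1}"
        using that
      proof (induction n rule: dec_induct)
        case base
        then show ?case by (rule N)
      next
        case (step n)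
        have "fold_line (real (d n) * t) \<in> {0, 1}" if "t \<in> {0, 1}" for t
          using that fold_line_of_nat[of "d n"] fold_line_id[of 0] by auto
        then show ?case using coord(3)[OF cK[OF y], of n] step by metis
      qed
      then show ?thesis
        using homeo_commuting_coordinate_0[OF tent_presentation_shift[OF tp, of n] c comm y] by simp
    qed
    then have "c y = y" by (rule tent_presentation_eqI[OF tp cK[OF y] y])
    with ne show False by simp
  qed
  obtain Q where Q: "homeomorphic_maps K ?L ?P Q"
    using tp homeomorphic_map_maps unfolding tent_presentation_def by blast
  \<comment> \<open>A ray from the zero point \<open>z 0\<close>: near 0 the bonding maps are multiplications by the
    degrees. Its other points with \<open>t < 1\<close> are outside \<open>E\<close>, hence fixed by \<open>c\<close>.\<close>
  define z where "z t = Q (\<lambda>n. t / ?D n)" for t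
  have ray: "(\<lambda>n. t / ?D n) \<in> topspace ?L" if "t \<in> {0..1}" for t
  proof -
    have "0 \<le> t / ?D n" "t / ?D n \<le> 1" for n
      using that D[of n] by (auto simp: divide_simps simp del: of_nat_prod)
    moreover have "tent_map (d n) (t / ?D (Suc n)) = t / ?D n" for n
    proof -
      have "real (d n) * (t / ?D (Suc n)) = t / ?D n" using d[of n] by simp
      then show ?thesis using calculation[of n] by (metis fold_line_id tent_map_eq_fold_line)
    qed
    ultimately show ?thesis by (simp add: topspace_inverse_limit)
  qed
  have Qc: "continuous_map ?L K Q" and PQ: "\<And>y. y \<in> topspace ?L \<Longrightarrow> ?P (Q y) = y"
    using Q by (auto simp: homeomorphic_maps_def)
  have "continuous_map I_top ?L (\<lambda>t n. t / ?D n)"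
    unfolding continuous_map_inverse_limit_iff
  proof (intro conjI allI ballI)
    fix n
    have "continuous_on {0..1} (\<lambda>t. t / ?D n)"
      using d0 by (intro continuous_intros) simp
    then show "continuous_map I_top I_top (\<lambda>t. t / ?D n)"
      using ray unfolding topspace_inverse_limit by auto
    show "tent_map (d n) (t / ?D (Suc n)) = t / ?D n" if "t \<in> topspace I_top" for t
      using ray[of t] that unfolding topspace_inverse_limit by auto
  qed
  then have zc: "continuous_map I_top K z"
    unfolding z_def using continuous_map_compose[OF _ Qc] by (auto simp: o_def)
  have zK: "z t \<in> topspace K" if "t \<in> {0..1}" for t
    using that zc by (auto simp: continuous_map_def)
  have pz: "p n (z t) = t / ?D n" if "t \<in> {0..1}" for n t
    using PQ[OF ray[OF that]] by (metis z_def)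
  have fix_ray: "c (z t) = z t" if t: "t \<in> {0<..<1}" for t
  proof -
    have "z t \<in> topspace K" using t by (intro zK) auto
    then obtain w where w: "w \<in> topspace K" "c w = z t"
      using homeomorphic_imp_surjective_map[OF c] by (metis imageE)
    have "p 0 (z t) = t" using t pz[of t 0] by simp
    then have "p 0 (c w) \<notin> {0, 1}" using t w by simp
    then have "c w \<notin> E" unfolding E_def by blast
    then show ?thesis using moved[OF w(1)] w by metis
  qed
  have "p n (c (z 0)) = p n (z 0)" for n
  proof -
    have "continuous_map K I_top (p n)"
      using Q continuous_map_compose[of K ?L ?P I_top "\<lambda>x. x n"]
        continuous_map_inverse_limit_coordinate
      by (auto simp: homeomorphic_maps_def o_def)
    from continuous_map_compose[OF
        continuous_map_compose[OF zc homeomorphic_imp_continuous_map[OF c]] this]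
    have "continuous_map I_top I_top (p n \<circ> (c \<circ> z))" .
    then have "continuous_on {0..1} (\<lambda>t. p n (c (z t)) - t / ?D n)"
      using d0 by (intro continuous_intros) (simp_all add: o_def)
    then have "continuous_on (closure {0<..<1}) (\<lambda>t. p n (c (z t)) - t / ?D n)" by simp
    moreover have "p n (c (z t)) - t / ?D n = 0" if "t \<in> {0<..<1}" for t
      using fix_ray[OF that] pz[of t n] that by simp
    moreover have "(0 :: real) \<in> closure {0<..<1}"
      by (simp only: closure_greaterThanLessThan[OF zero_less_one]) simp
    ultimately have "p n (c (z 0)) - 0 / ?D n = 0"
      by (rule continuous_constant_on_closure[where a = 0])
    then show ?thesis using pz[of 0 n] by simp
  qed
  then have z0: "c (z 0) = z 0"
    using tent_presentation_eqI[OF tp cK] zK[of 0] by auto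
  \<comment> \<open>Tent maps send 0 to 0, so a nonzero coordinate forces all later ones to be nonzero, which
    inside \<open>E\<close> means equal to 1.\<close>
  have E_unique: "y = y'" if E: "y \<in> E" "y' \<in> E" and nz: "y \<noteq> z 0" "y' \<noteq> z 0" for y y'
  proof -
    have ev1: "\<exists>N. \<forall>n\<ge>N. p n u = 1" if u: "u \<in> E" "u \<noteq> z 0" for u
    proof -
      have uK: "u \<in> topspace K" using u by (simp add: E_def)
      obtain N where "p N u \<noteq> p N (z 0)"
        using tent_presentation_eqI[OF tp uK zK[of 0]] u by auto
      then have N: "p N u \<noteq> 0" using pz[of 0 N] by simp
      have "p n u \<noteq> 0" if "N \<le> n" for n
        using that
      proof (induction n rule: dec_induct)
        case base
        then show ?case by (rule N)
      next
        case (step n)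
        then show ?case using coord(3)[OF uK, of n] fold_line_id[of 0] by auto
      qed
      then show ?thesis using u by (auto simp: E_def)
    qed
    obtain N N' where "\<forall>n\<ge>N. p n y = 1" "\<forall>n\<ge>N'. p n y' = 1" using ev1 E nz by metis
    then have "p n y = p n y'" if "max N N' \<le> n" for n using that by simp
    moreover have "y \<in> topspace K" "y' \<in> topspace K" using E by (auto simp: E_def)
    ultimately show ?thesis using tent_presentation_eqI[OF tp, of y y' "max N N'"] by blast
  qed
  show ?thesis
  proof (rule ccontr)
    assume ne: "c x \<noteq> x"
    have ne2: "c (c x) \<noteq> c x" using inj_onD[OF c_inj _ cK[OF x] x] ne by blast
    have z0K: "z 0 \<in> topspace K" by (rule zK) simp
    have avoid: "c y \<noteq> z 0" if "y \<in> topspace K" "c y \<noteq> y" for y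
      using inj_onD[OF c_inj _ that(1) z0K] that(2) z0 by force
    have "c (c x) = c x"
      using E_unique moved[OF cK[OF x] ne2] moved[OF x ne] avoid[OF cK[OF x] ne2] avoid[OF x ne]
      by blast
    with ne2 show False by simp
  qed
qed

section \<open>Telling the groups apart\<close>

lemma carrier_Homeo: "carrier (Homeo K) = {f \<in> Bij (topspace K). homeomorphic_map K K f}"
  by (simp add: Homeo_def)

lemma mult_Homeo:
  assumes "f \<in> carrier (Homeo K)" "g \<in> carrier (Homeo K)"
  shows "f \<otimes>\<^bsub>Homeo K\<^esub> g = compose (topspace K) f g"
  using assms by (simp add: Homeo_def BijGroup_def)

lemma restrict_homeomorphic_map_in_Homeo:
  assumes "homeomorphic_map K K h"
  shows "restrict h (topspace K) \<in> carrier (Homeo K)"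
proof -
  have "homeomorphic_map K K (restrict h (topspace K))"
    using assms by (rule homeomorphic_map_eq) simp
  moreover have "bij_betw h (topspace K) (topspace K)"
    using homeomorphic_imp_injective_map[OF assms] homeomorphic_imp_surjective_map[OF assms]
    by (simp add: bij_betw_def)
  ultimately show ?thesis
    by (simp add: carrier_Homeo Bij_def)
qed

lemma monoid_Homeo: "monoid (Homeo K)"
proof -
  interpret B: group "BijGroup (topspace K)" by (rule group_BijGroup)
  have one: "restrict id (topspace K) \<in> carrier (Homeo K)"
    by (rule restrict_homeomorphic_map_in_Homeo) simp
  have closed: "f \<otimes>\<^bsub>Homeo K\<^esub> g \<in> carrier (Homeo K)"
    if "f \<in> carrier (Homeo K)" "g \<in> carrier (Homeo K)" for f g
    using that restrict_homeomorphic_map_in_Homeo[of K "f \<circ> g"]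
      homeomorphic_map_compose[of K K g K f]
    by (auto simp: mult_Homeo carrier_Homeo compose_def o_def)
  have "submonoid (carrier (Homeo K)) (BijGroup (topspace K))"
    using one closed
    by unfold_locales (auto simp: Homeo_def BijGroup_def id_def)
  then show ?thesis
    using submonoid.submonoid_is_monoid[OF _ B.is_monoid] by (simp add: Homeo_def)
qed

lemma Homeo_centre_trivial:
  assumes tp: "tent_presentation K d p" and c: "c \<in> carrier (Homeo K)"
    and comm: "\<And>f. f \<in> carrier (Homeo K) \<Longrightarrow> c \<otimes>\<^bsub>Homeo K\<^esub> f = f \<otimes>\<^bsub>Homeo K\<^esub> c"
  shows "c = \<one>\<^bsub>Homeo K\<^esub>"
proof -
  have cK: "homeomorphic_map K K c" "c \<in> extensional (topspace K)"
    using c by (auto simp: carrier_Homeo Bij_def)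
  have "c (h x) = h (c x)" if h: "homeomorphic_map K K h" and x: "x \<in> topspace K" for h x
  proof -
    let ?h = "restrict h (topspace K)"
    have "compose (topspace K) c ?h x = compose (topspace K) ?h c x"
      using comm[of ?h] mult_Homeo c restrict_homeomorphic_map_in_Homeo[OF h] by metis
    moreover have "c x \<in> topspace K"
      using homeomorphic_imp_surjective_map[OF cK(1)] x by blast
    ultimately show ?thesis using x by (simp add: compose_def)
  qed
  then have "c x = x" if "x \<in> topspace K" for x
    using homeo_commuting_imp_id[OF tp cK(1)] that by blast
  then show ?thesis
    using cK(2) by (auto simp: Homeo_def BijGroup_def fun_eq_iff extensional_def)
qed

text \<open>An isomorphism sends the unit of \<open>G\<close> to a pair whose first component \<open>e\<close> is a two-sided unit of
  \<open>N\<close>, and so each \<open>(e, t)\<close> is central. Getting \<open>e\<close> from the isomorphism avoids a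
  proof that \<open>N\<close>, in the application the kernel of the degree function, is a group.\<close>

lemma trivial_centre_not_iso_DirProd:
  assumes "monoid G" "comm_monoid H"
    and centre: "\<And>c. c \<in> carrier G \<Longrightarrow> (\<And>x. x \<in> carrier G \<Longrightarrow> c \<otimes>\<^bsub>G\<^esub> x = x \<otimes>\<^bsub>G\<^esub> c) \<Longrightarrow> c = \<one>\<^bsub>G\<^esub>"
    and H: "q \<in> carrier H" "r \<in> carrier H" "q \<noteq> r"
  shows "\<not> G \<cong> N \<times>\<times> H"
proof
  interpret G: monoid G by fact
  interpret H: comm_monoid H by fact
  assume "G \<cong> N \<times>\<times> H"
  then obtain \<psi> where hom: "\<psi> \<in> hom G (N \<times>\<times> H)"
    and bij: "bij_betw \<psi> (carrier G) (carrier N \<times> carrier H)"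
    by (auto simp: is_iso_def iso_def)
  obtain e s where es: "\<psi> \<one>\<^bsub>G\<^esub> = (e, s)" by fastforce
  have e: "e \<in> carrier N" using bij_betwE[OF bij] G.one_closed es by force
  have unit: "e \<otimes>\<^bsub>N\<^esub> a = a" "a \<otimes>\<^bsub>N\<^esub> e = a" if "a \<in> carrier N" for a
  proof -
    have "(a, q) \<in> \<psi> ` carrier G" using bij that H by (simp add: bij_betw_def)
    then obtain x where x: "x \<in> carrier G" "\<psi> x = (a, q)" by force
    have "\<psi> \<one>\<^bsub>G\<^esub> \<otimes>\<^bsub>N \<times>\<times> H\<^esub> \<psi> x = \<psi> x" "\<psi> x \<otimes>\<^bsub>N \<times>\<times> H\<^esub> \<psi> \<one>\<^bsub>G\<^esub> = \<psi> x"
      using hom_mult[OF hom G.one_closed x(1)] hom_mult[OF hom x(1) G.one_closed] x(1)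
      by simp_all
    then show "e \<otimes>\<^bsub>N\<^esub> a = a" "a \<otimes>\<^bsub>N\<^esub> e = a"
      by (auto simp: x es)
  qed
  have "\<psi> \<one>\<^bsub>G\<^esub> = (e, t)" if t: "t \<in> carrier H" for t
  proof -
    have "(e, t) \<in> \<psi> ` carrier G" using bij e t by (simp add: bij_betw_def)
    then obtain c where c: "c \<in> carrier G" "\<psi> c = (e, t)" by force
    have "c \<otimes>\<^bsub>G\<^esub> x = x \<otimes>\<^bsub>G\<^esub> c" if x: "x \<in> carrier G" for x
    proof -
      obtain a u where au: "\<psi> x = (a, u)" by fastforce
      have "a \<in> carrier N" "u \<in> carrier H" using bij_betwE[OF bij] x au by force+
      then have "\<psi> (c \<otimes>\<^bsub>G\<^esub> x) = \<psi> (x \<otimes>\<^bsub>G\<^esub> c)"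
        using hom_mult[OF hom] c x t au unit H.m_comm by simp
      then show ?thesis
        using bij c x by (meson G.m_closed bij_betw_def inj_onD)
    qed
    then show ?thesis using centre c by metis
  qed
  then show False using H by (metis prod.inject)
qed

theorem proposition7p10:
  fixes K :: "'a topology" and d :: "nat \<Rightarrow> nat" and p :: "nat \<Rightarrow> 'a \<Rightarrow> real"
  assumes "universal_knaster_continuum K"
    and "tent_presentation K d p"
  shows "\<not> Homeo K \<cong> Homeo1 K d p \<times>\<times> pos_rat_group"
proof (rule trivial_centre_not_iso_DirProd[OF monoid_Homeo])
  show "comm_monoid pos_rat_group"
    by unfold_locales (auto simp: pos_rat_group_def)
  show "(1 :: rat) \<in> carrier pos_rat_group" "(2 :: rat) \<in> carrier pos_rat_group"
    by (auto simp: pos_rat_group_def)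
  show "c = \<one>\<^bsub>Homeo K\<^esub>"
    if "c \<in> carrier (Homeo K)"
      "\<And>f. f \<in> carrier (Homeo K) \<Longrightarrow> c \<otimes>\<^bsub>Homeo K\<^esub> f = f \<otimes>\<^bsub>Homeo K\<^esub> c" for c
    using Homeo_centre_trivial[OF assms(2)] that by blast
qed simp

end
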